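(* A generalized Petersen graph $\Gamma=\mathrm{GP}(n,s)$, where $s\in\mathbb{Z}_n\setminus\{0,n/2\}$, is edge-transitive (and thus arc-transitive) if and only if $(n,s)$ is one of the following pairs: $(4,1)$, $(5,2)$, $(8,3)$, $(10,2)$, $(10,3)$, $(12,5)$, or $(24,5)$.
   Context: For a positive integer $n$ and $s\in\mathbb{Z}_n\setminus\{0,n/2\}$ (the exclusion of $n/2$ being relevant only for even $n$), the generalized Petersen graph $\mathrm{GP}(n,s)$ is the bicirculant relative to the cyclic group $H=\mathbb{Z}_n$ (that is, a graph on which $H$ acts semiregularly by automorphisms with two orbits of equal size) admitting the symbol $S_{11}=\{1,-1\}$, $S_{12}=S_{21}=\{0\}$, $S_{22}=\{s,-s\}$. Here, for chosen points of reference $b_1,b_2$ in the two $H$-orbits, $S_{ij}$ is the set of all $h\in H$ such that $b_i$ is adjacent to $b_j^h$. Explicitly, writing $u_i=b_1^i$ and $v_i=b_2^i$ for $i\in\mathbb{Z}_n$, $\mathrm{GP}(n,s)$ is the undirected graph with the $2n$ vertices $u_i,v_i$ and edges $\{u_i,u_{i+1}\}$, $\{u_i,v_i\}$, $\{v_i,v_{i+s}\}$ for $i\in\mathbb{Z}_n$. A graph is edge-transitive (respectively arc-transitive) if its automorphism group acts transitively on its edges (respectively on its arcs, i.e. ordered pairs of adjacent vertices).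
   Formalization: The list of pairs is read up to replacing s by −s: the condition proved is that (n,s) or (n,−s) is listed, since GP(n,−s) = GP(n,s) and, for example, the Petersen graph GP(5,3) = GP(5,2) is edge-transitive although (5,3) is not listed. *)

theory Defs
  imports "Graph_Theory.Pair_Digraph" "HOL-Combinatorics.Permutations"
begin

text \<open>
  An undirected simple graph is a \<^term>\<open>pair_graph\<close>: its arc relation is symmetric and
  irreflexive, and each undirected edge is represented by its two arcs.
\<close>

definition undirected_edges :: "'a pair_pre_digraph \<Rightarrow> 'a set set" where
  "undirected_edges G = {{u, v} | u v. (u, v) \<in> parcs G}"

definition automorphisms :: "'a pair_pre_digraph \<Rightarrow> ('a \<Rightarrow> 'a) set" where
  "automorphisms G = {f. f permutes pverts G \<and>
     (\<forall>u\<in>pverts G. \<forall>v\<in>pverts G. (f u, f v) \<in> parcs G \<longleftrightarrow> (u, v) \<in> parcs G)}"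

definition edge_transitive :: "'a pair_pre_digraph \<Rightarrow> bool" where
  "edge_transitive G \<longleftrightarrow>
     (\<forall>e\<in>undirected_edges G. \<forall>e'\<in>undirected_edges G. \<exists>f\<in>automorphisms G. f ` e = e')"

definition arc_transitive :: "'a pair_pre_digraph \<Rightarrow> bool" where
  "arc_transitive G \<longleftrightarrow>
     (\<forall>a\<in>parcs G. \<forall>a'\<in>parcs G. \<exists>f\<in>automorphisms G. map_prod f f a = a')"

text \<open>
  The cyclic group of order \<open>n\<close> is represented by the residues \<open>{0..<n}\<close> with addition
  modulo \<open>n\<close>; \<open>U i\<close> and \<open>V i\<close> are the points of the two orbits.
\<close>

datatype gp_vertex = U nat | V nat

definition generalized_petersen :: "nat \<Rightarrow> nat \<Rightarrow> gp_vertex pair_pre_digraph" where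
  "generalized_petersen n s =
     \<lparr> pverts = U ` {0..<n} \<union> V ` {0..<n},
       parcs = symcl ((\<lambda>i. (U i, U ((i + 1) mod n))) ` {0..<n} \<union>
                      (\<lambda>i. (U i, V i)) ` {0..<n} \<union>
                      (\<lambda>i. (V i, V ((i + s) mod n))) ` {0..<n}) \<rparr>"

lemma pair_graph_generalized_petersen:
  assumes "s \<in> {0..<n} - {0}" "2 * s \<noteq> n"
  shows "pair_graph (generalized_petersen n s)"
proof -
  have n: "n \<ge> 3" using assms by auto
  have step: "(i + t) mod n \<noteq> i" if "i < n" "0 < t" "t < n" for i t
    using that by (cases "i + t < n") (auto simp: mod_if)
  show ?thesis
  proof
    show "finite (pverts (generalized_petersen n s))"
      and "finite (parcs (generalized_petersen n s))"
      by (auto simp: generalized_petersen_def symcl_def)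
    show "symmetric (with_proj (generalized_petersen n s))"
      by (auto simp: symmetric_def sym_def generalized_petersen_def symcl_def)
  next
    fix e assume e: "e \<in> parcs (generalized_petersen n s)"
    show "fst e \<in> pverts (generalized_petersen n s)"
      and "snd e \<in> pverts (generalized_petersen n s)"
      using e by (auto simp: generalized_petersen_def symcl_def)
    show "fst e \<noteq> snd e"
      using e step[of _ 1] step[of _ s] n assms
      by (fastforce simp: generalized_petersen_def symcl_def)
  qed
qed

text \<open>
  The parameters \<open>s\<close> and \<open>-s\<close> of \<open>\<int>\<^sub>n\<close> define the same graph, so a list of pairs
  \<open>(n, s)\<close> can only be exhaustive up to the sign of \<open>s\<close>.
\<close>

lemma generalized_petersen_uminus:
  assumes "s < n"
  shows "generalized_petersen n (n - s) = generalized_petersen n s"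
proof -
  define A where "A t = (\<lambda>i. (V i, V ((i + t) mod n))) ` {0..<n}" for t
  have sub: "A t \<subseteq> (A (n - t))\<inverse>" if "t \<le> n" for t
  proof
    fix x assume "x \<in> A t"
    then obtain i where i: "i < n" and x: "x = (V i, V ((i + t) mod n))"
      by (auto simp: A_def)
    have "((i + t) mod n + (n - t)) mod n = (i + t + (n - t)) mod n"
      by (rule mod_add_left_eq)
    also have "\<dots> = i" using i that by simp
    finally have "(V ((i + t) mod n), V i) \<in> A (n - t)"
      using i by (auto simp: A_def intro!: image_eqI[where x = "(i + t) mod n"])
    then show "x \<in> (A (n - t))\<inverse>" using x by simp
  qed
  have "A (n - s) = (A s)\<inverse>"
    using sub[of s] sub[of "n - s"] assms by auto
  moreover have "symcl (B \<union> C \<union> R\<inverse>) = symcl (B \<union> C \<union> R)" for B C R :: "gp_vertex rel"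
    by (auto simp: symcl_def image_iff split: prod.splits)
  ultimately show ?thesis
    by (simp add: generalized_petersen_def A_def)
qed

end

theory Submission
  imports Defs
begin

text \<open>
  Reflections reverse outer edges, so edge-transitivity gives arc-transitivity, and then an
  outer arc, a spoke and an inner arc lie on equally many closed walks of length \<open>8\<close>
  without backtracking. Besides the octagons present in every \<open>GP(n, s)\<close>, such walks come from
  congruences \<open>i + j s = 0\<close> modulo \<open>n\<close>. Eliminating the contributions of the three kinds of
  arcs shows that, for \<open>n > 8\<close>, at least two of the ten congruences with \<open>i + \<bar>j\<bar> = 6\<close> and
  \<open>i, \<bar>j\<bar> \<ge> 1\<close> hold, so that \<open>n\<close> divides the determinant of two distinct coefficient
  vectors and is at most \<open>26\<close>. The remaining cases are finite in number; the length \<open>8\<close>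
  does not exclude \<open>(13, 5)\<close> and \<open>(26, 5)\<close>, which the lengths \<open>7\<close> and \<open>10\<close> do.
  Conversely, each listed graph has an automorphism mixing the three kinds of edges.
\<close>

section \<open>Closed walks without backtracking\<close>

text \<open>These are the entries of the powers of the Hashimoto edge matrix. On the diagonal the
  last arc equals the first, so a closed walk does not backtrack at its base point either.\<close>

primrec arc_walks :: "'a pair_pre_digraph \<Rightarrow> nat \<Rightarrow> 'a \<times> 'a \<Rightarrow> 'a \<times> 'a \<Rightarrow> nat" where
  "arc_walks G 0 a b = of_bool (a = b)"
| "arc_walks G (Suc k) a b =
     (\<Sum>c | c \<in> parcs G \<and> fst c = snd a \<and> snd c \<noteq> fst a. arc_walks G k c b)"

lemma automorphism_permutes: "f \<in> automorphisms G \<Longrightarrow> f permutes pverts G"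
  by (simp add: automorphisms_def)

lemma automorphism_arc_iff:
  assumes "f \<in> automorphisms G" "parcs G \<subseteq> pverts G \<times> pverts G"
  shows "map_prod f f a \<in> parcs G \<longleftrightarrow> a \<in> parcs G"
proof -
  obtain u v where a: "a = (u, v)" by force
  have "f x \<in> pverts G \<longleftrightarrow> x \<in> pverts G" for x
    using permutes_in_image[OF automorphism_permutes[OF assms(1)]] .
  then show ?thesis using assms unfolding a automorphisms_def by auto
qed

text \<open>An automorphism maps the continuations of an arc bijectively onto those of its image, so
  the counts agree by induction on the length.\<close>

lemma arc_walks_automorphism:
  assumes f: "f \<in> automorphisms G" and sub: "parcs G \<subseteq> pverts G \<times> pverts G"
  shows "arc_walks G k (map_prod f f a) (map_prod f f b) = arc_walks G k a b"
proof -
  have p: "f permutes pverts G" using f by (rule automorphism_permutes)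
  have inj: "f x = f y \<longleftrightarrow> x = y" for x y
    using permutes_inj[OF p] by (auto dest: injD)
  have pinj: "inj (map_prod f f)"
    by (auto simp: inj_def inj)
  show ?thesis
  proof (induction k arbitrary: a)
    case 0
    show ?case using pinj by (auto dest: injD)
  next
    case (Suc k)
    have "{c. c \<in> parcs G \<and> fst c = snd (map_prod f f a) \<and> snd c \<noteq> fst (map_prod f f a)} =
          map_prod f f ` {c. c \<in> parcs G \<and> fst c = snd a \<and> snd c \<noteq> fst a}" (is "?L = _ ` ?R")
    proof (intro equalityI subsetI)
      fix c assume c: "c \<in> ?L"
      define d where "d = map_prod (inv f) (inv f) c"
      have cd: "c = map_prod f f d"
        using permutes_inverses(1)[OF p] by (simp add: d_def map_prod_def split: prod.splits)
      have "d \<in> ?R"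
        using c automorphism_arc_iff[OF f sub, of d] by (auto simp: cd inj)
      then show "c \<in> map_prod f f ` ?R" using cd by blast
    next
      fix c assume "c \<in> map_prod f f ` ?R"
      then show "c \<in> ?L" using automorphism_arc_iff[OF f sub] by (auto simp: inj)
    qed
    then show ?case
      using Suc by (simp add: sum.reindex[OF inj_on_subset[OF pinj subset_UNIV]])
  qed
qed

lemma arc_transitive_arc_walks:
  assumes "arc_transitive G" "parcs G \<subseteq> pverts G \<times> pverts G" "a \<in> parcs G" "b \<in> parcs G"
  shows "arc_walks G k a a = arc_walks G k b b"
proof -
  obtain f where "f \<in> automorphisms G" "map_prod f f a = b"
    using assms unfolding arc_transitive_def by blast
  then show ?thesis using arc_walks_automorphism assms(2) by metis
qed

section \<open>Criteria for automorphisms and arc-transitivity\<close>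

lemma automorphisms_id: "id \<in> automorphisms G"
  by (simp add: automorphisms_def permutes_id)

lemma automorphisms_comp:
  assumes "f \<in> automorphisms G" "g \<in> automorphisms G"
  shows "g \<circ> f \<in> automorphisms G"
  using assms permutes_in_image[of f "pverts G"]
  by (auto simp: automorphisms_def intro: permutes_compose)

lemma automorphisms_inv:
  assumes "f \<in> automorphisms G"
  shows "inv f \<in> automorphisms G"
proof -
  have p: "f permutes pverts G" using assms by (rule automorphism_permutes)
  have "(inv f u, inv f v) \<in> parcs G \<longleftrightarrow> (u, v) \<in> parcs G"
    if "u \<in> pverts G" "v \<in> pverts G" for u v
  proof -
    have "inv f u \<in> pverts G" "inv f v \<in> pverts G"
      using that permutes_in_image[OF permutes_inv[OF p]] by auto
    then have "(f (inv f u), f (inv f v)) \<in> parcs G \<longleftrightarrow> (inv f u, inv f v) \<in> parcs G"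
      using assms unfolding automorphisms_def by blast
    then show ?thesis by (simp add: permutes_inverses(1)[OF p])
  qed
  then show ?thesis using permutes_inv[OF p] by (simp add: automorphisms_def)
qed

text \<open>An injective self-map of the finite arc set is onto, so preserving arcs already implies
  reflecting them.\<close>

lemma automorphismI:
  assumes p: "f permutes pverts G" and fin: "finite (parcs G)"
    and arc: "\<And>u v. (u, v) \<in> parcs G \<Longrightarrow> (f u, f v) \<in> parcs G"
  shows "f \<in> automorphisms G"
proof -
  have inj: "inj (map_prod f f)"
    using permutes_inj[OF p] by (simp add: prod.inj_map)
  have "map_prod f f ` parcs G = parcs G"
  proof (rule endo_inj_surj[OF fin])
    show "map_prod f f ` parcs G \<subseteq> parcs G" using arc by auto
    show "inj_on (map_prod f f) (parcs G)" using inj by (rule inj_on_subset) simp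
  qed
  then have "(f u, f v) \<in> parcs G \<longleftrightarrow> (u, v) \<in> parcs G" for u v
    using inj_image_mem_iff[OF inj, of "(u, v)" "parcs G"] by simp
  then show ?thesis using p by (simp add: automorphisms_def)
qed

text \<open>Two arcs reached from the common base pair \<open>c\<close> by \<open>f\<close> and
  \<open>g\<close> are related by \<open>g \<circ> inv f\<close>.\<close>

lemma arc_transitiveI:
  assumes "\<And>a. a \<in> parcs G \<Longrightarrow> \<exists>f\<in>automorphisms G. map_prod f f c = a"
  shows "arc_transitive G"
  unfolding arc_transitive_def
proof (intro ballI)
  fix a b assume "a \<in> parcs G" "b \<in> parcs G"
  then obtain f g where f: "f \<in> automorphisms G" "map_prod f f c = a"
    and g: "g \<in> automorphisms G" "map_prod g g c = b"
    using assms by blast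
  have "map_prod (g \<circ> inv f) (g \<circ> inv f) a = b"
    using permutes_inverses(2)[OF automorphism_permutes[OF f(1)]] f(2) g(2)
    by (auto simp: map_prod_def split: prod.splits)
  then show "\<exists>h\<in>automorphisms G. map_prod h h a = b"
    using automorphisms_comp[OF automorphisms_inv[OF f(1)] g(1)] by blast
qed

lemma arc_transitive_imp_edge_transitive:
  assumes "arc_transitive G"
  shows "edge_transitive G"
  unfolding edge_transitive_def undirected_edges_def
proof (clarify)
  fix u v u' v' assume "(u, v) \<in> parcs G" "(u', v') \<in> parcs G"
  then obtain f where "f \<in> automorphisms G" "f u = u'" "f v = v'"
    using assms unfolding arc_transitive_def by fastforce
  then show "\<exists>f\<in>automorphisms G. f ` {u, v} = {u', v'}" by auto
qed

text \<open>A single edge that can be reversed already rules out the half-arc-transitive case.\<close>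

lemma edge_transitive_imp_arc_transitive:
  assumes et: "edge_transitive G" and xy: "(x, y) \<in> parcs G"
    and h: "h \<in> automorphisms G" "h x = y" "h y = x"
  shows "arc_transitive G"
proof (rule arc_transitiveI[where c = "(x, y)"])
  fix a assume a: "a \<in> parcs G"
  obtain u v where uv: "a = (u, v)" by force
  have "{x, y} \<in> undirected_edges G" "{u, v} \<in> undirected_edges G"
    using xy a uv by (auto simp: undirected_edges_def)
  then obtain f where f: "f \<in> automorphisms G" "f ` {x, y} = {u, v}"
    using et unfolding edge_transitive_def by blast
  then consider "f x = u" "f y = v" | "f x = v" "f y = u"
    by (auto simp: doubleton_eq_iff)
  then show "\<exists>f\<in>automorphisms G. map_prod f f (x, y) = a"
  proof cases
    case 1
    then show ?thesis using f uv by auto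
  next
    case 2
    then show ?thesis
      using automorphisms_comp[OF h(1) f(1)] h uv by (intro bexI[of _ "f \<circ> h"]) auto
  qed
qed

section \<open>Arcs of generalized Petersen graphs\<close>

text \<open>Positions are integers, reduced modulo \<open>n\<close> only when a vertex is formed, so
  that rotations, reflections and inner steps become plain affine arithmetic.\<close>

definition point :: "nat \<Rightarrow> bool \<Rightarrow> int \<Rightarrow> gp_vertex" where
  "point n b x = (if b then U else V) (nat (x mod int n))"


definition step :: "nat \<Rightarrow> bool \<Rightarrow> int \<Rightarrow> int" where
  "step s b d = d * (if b then 1 else int s)"

text \<open>The direction \<open>d\<close> is \<open>0\<close> for a spoke and \<open>1\<close> or \<open>-1\<close> for the two rim arcs at a
  vertex, so that the reverse of an arc of direction \<open>d\<close> has direction \<open>-d\<close>.\<close>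

definition gp_arc :: "nat \<Rightarrow> nat \<Rightarrow> bool \<Rightarrow> int \<Rightarrow> int \<Rightarrow> gp_vertex \<times> gp_vertex" where
  "gp_arc n s b d x = (point n b x, point n (b \<noteq> (d = 0)) (x + step s b d))"

lemma point_eq_iff:
  assumes "0 < n"
  shows "point n b x = point n b' y \<longleftrightarrow> b = b' \<and> int n dvd x - y"
  using assms by (auto simp: point_def nat_eq_iff mod_eq_dvd_iff)

lemma U_eq_point: "i < n \<Longrightarrow> U i = point n True (int i)"
  and V_eq_point: "i < n \<Longrightarrow> V i = point n False (int i)"
  by (simp_all add: point_def)

lemma U_mod_eq_point: "U (i mod n) = point n True (int i)"
  and V_mod_eq_point: "V (i mod n) = point n False (int i)"
  by (simp_all add: point_def nat_mod_distrib)

lemma periodic_range: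
  assumes "0 < n" "\<And>x y. int n dvd x - y \<Longrightarrow> f x = f y"
  shows "range f = (\<lambda>i. f (int i)) ` {0..<n}"
proof -
  have "f x \<in> (\<lambda>i. f (int i)) ` {0..<n}" for x
  proof
    show "f x = f (int (nat (x mod int n)))"
      using assms by (intro assms(2)) (simp add: mod_eq_dvd_iff[symmetric])
    show "nat (x mod int n) \<in> {0..<n}" using assms(1) by (simp add: nat_less_iff)
  qed
  then show ?thesis by auto
qed

lemma range_point:
  assumes "0 < n"
  shows "range (point n b) = (if b then U else V) ` {0..<n}"
proof -
  have "range (point n b) = (\<lambda>i. point n b (int i)) ` {0..<n}"
    using assms by (intro periodic_range) (simp_all add: point_eq_iff)
  then show ?thesis by (simp add: point_def)
qed

lemma gp_arc_periodic:
  assumes "0 < n" "int n dvd x - y"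
  shows "gp_arc n s b d x = gp_arc n s b d y"
  using assms by (simp add: gp_arc_def point_eq_iff)

lemma swap_gp_arc:
  "prod.swap (gp_arc n s b d x) = gp_arc n s (b \<noteq> (d = 0)) (- d) (x + step s b d)"
  by (auto simp: gp_arc_def step_def)

lemma pverts_generalized_petersen:
  assumes "0 < n"
  shows "pverts (generalized_petersen n s) = (\<Union>b. range (point n b))"
  using assms by (auto simp: generalized_petersen_def range_point UNIV_bool)

lemma parcs_generalized_petersen:
  assumes n: "0 < n"
  shows "parcs (generalized_petersen n s) = (\<Union>b. \<Union>d\<in>{-1, 0, 1}. range (gp_arc n s b d))"
    (is "_ = ?R")
proof -
  have range: "range (gp_arc n s b d) = (\<lambda>i. gp_arc n s b d (int i)) ` {0..<n}" for b d
    by (rule periodic_range[OF n]) (rule gp_arc_periodic[OF n])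
  have "(\<lambda>i. (U i, U ((i + 1) mod n))) ` {0..<n} = range (gp_arc n s True 1)"
    and "(\<lambda>i. (U i, V i)) ` {0..<n} = range (gp_arc n s True 0)"
    and "(\<lambda>i. (V i, V ((i + s) mod n))) ` {0..<n} = range (gp_arc n s False 1)"
    unfolding range
    by (auto intro!: image_cong
        simp: gp_arc_def step_def add.commute U_eq_point[of _ n] V_eq_point[of _ n] U_mod_eq_point V_mod_eq_point)
  then have "parcs (generalized_petersen n s) =
     symcl (range (gp_arc n s True 1) \<union> range (gp_arc n s True 0) \<union> range (gp_arc n s False 1))"
    by (simp only: generalized_petersen_def pair_pre_digraph.simps)
  also have "\<dots> = range (gp_arc n s True 1) \<union> range (gp_arc n s True 0) \<union> range (gp_arc n s False 1)
     \<union> range (gp_arc n s True (-1)) \<union> range (gp_arc n s False 0) \<union> range (gp_arc n s False (-1))"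
  proof -
    have swap: "prod.swap ` range (gp_arc n s b d) = range (gp_arc n s (b \<noteq> (d = 0)) (- d))" for b d
    proof -
      have "prod.swap ` range (gp_arc n s b d) =
          gp_arc n s (b \<noteq> (d = 0)) (- d) ` range (\<lambda>x. x + step s b d)"
        by (simp only: image_image swap_gp_arc)
      moreover have "range (\<lambda>x. x + step s b d) = UNIV"
        by (rule surjI[of _ "\<lambda>x. x - step s b d"]) simp
      ultimately show ?thesis by simp
    qed
    have symcl: "symcl A = A \<union> prod.swap ` A" for A :: "gp_vertex rel"
      by (auto simp: symcl_def prod.swap_def split_beta)
    show ?thesis by (simp only: symcl image_Un swap) auto
  qed
  also have "\<dots> = ?R" by (simp add: UNIV_bool Un_ac)
  finally show ?thesis .
qed

lemma gp_arc_in_parcs: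
  assumes "0 < n" "d \<in> {-1, 0, 1}"
  shows "gp_arc n s b d x \<in> parcs (generalized_petersen n s)"
  unfolding parcs_generalized_petersen[OF assms(1)] using assms(2) by blast

lemma parcs_subset_generalized_petersen:
  assumes "0 < n"
  shows "parcs (generalized_petersen n s) \<subseteq>
    pverts (generalized_petersen n s) \<times> pverts (generalized_petersen n s)"
  using assms
  by (auto simp: pverts_generalized_petersen parcs_generalized_petersen gp_arc_def)

text \<open>The hypotheses force \<open>n \<ge> 3\<close>, and between \<open>0\<close> and
  \<open>2 * n\<close> the only multiple of \<open>n\<close> is \<open>n\<close> itself, which
  \<open>2 * s\<close> is not. This keeps the directions \<open>1\<close> and \<open>-1\<close>
  apart on both rims.\<close>

lemma not_dvd_double:
  assumes "0 < s" "s < n" "2 * s \<noteq> n"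
  shows "\<not> int n dvd 2" "\<not> int n dvd 2 * int s"
proof -
  show "\<not> int n dvd 2" using assms zdvd_imp_le[of "int n" 2] by auto
  show "\<not> int n dvd 2 * int s"
  proof
    assume "int n dvd 2 * int s"
    then have "n dvd 2 * s" using int_dvd_int_iff[of n "2 * s"] by simp
    then obtain k where k: "2 * s = n * k" by (elim dvdE)
    then have "n * k < n * 2" unfolding k[symmetric] using assms(2) by simp
    moreover have "0 < k" using k assms(1) by (auto intro: gr0I)
    ultimately have "k = 1" by simp
    then show False using k assms(3) by simp
  qed
qed

lemma gp_arc_eq_iff:
  assumes params: "0 < s" "s < n" "2 * s \<noteq> n" and d: "d \<in> {-1, 0, 1}" "d' \<in> {-1, 0, 1}"
  shows "gp_arc n s b d x = gp_arc n s b' d' y \<longleftrightarrow> b = b' \<and> d = d' \<and> int n dvd x - y"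
proof
  have n: "0 < n" using params by simp
  assume eq: "gp_arc n s b d x = gp_arc n s b' d' y"
  then have b: "b = b'" and xy: "int n dvd x - y"
    and d0: "d = 0 \<longleftrightarrow> d' = 0" and h: "int n dvd (x + step s b d) - (y + step s b' d')"
    using n by (auto simp: gp_arc_def point_eq_iff)
  have "int n dvd step s b d - step s b d'"
    using dvd_diff[OF h xy] b by (simp add: algebra_simps)
  then have "d = d'"
    using d d0 not_dvd_double[OF params] by (auto simp: step_def split: if_splits)
  then show "b = b' \<and> d = d' \<and> int n dvd x - y" using b xy by simp
next
  assume "b = b' \<and> d = d' \<and> int n dvd x - y"
  then show "gp_arc n s b d x = gp_arc n s b' d' y"
    using gp_arc_periodic[of n x y s b d] params by auto
qed

text \<open>Three arcs leave the head. An arc is determined by its ends, so the only one returning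
  to the tail is the reverse arc, which has direction \<open>- d\<close>.\<close>

lemma gp_arc_continuations:
  assumes params: "0 < s" "s < n" "2 * s \<noteq> n" and d: "d \<in> {-1, 0, 1}"
  shows "{c. c \<in> parcs (generalized_petersen n s) \<and> fst c = snd (gp_arc n s b d x) \<and>
             snd c \<noteq> fst (gp_arc n s b d x)} =
         (\<lambda>e. gp_arc n s (b \<noteq> (d = 0)) e (x + step s b d)) ` {e \<in> {-1, 0, 1}. e \<noteq> - d}"
    (is "?L = ?arc ` _")
proof -
  have n: "0 < n" using params by simp
  have swap: "prod.swap (gp_arc n s b d x) = ?arc (- d)" by (rule swap_gp_arc)
  have backtrack: "snd (?arc e) \<noteq> fst (gp_arc n s b d x) \<longleftrightarrow> e \<noteq> - d" if "e \<in> {-1, 0, 1}" for e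
  proof -
    have "snd (?arc e) = fst (gp_arc n s b d x) \<longleftrightarrow> ?arc e = ?arc (- d)"
      unfolding swap[symmetric] by (simp add: prod_eq_iff gp_arc_def)
    also have "\<dots> \<longleftrightarrow> e = - d"
      using d that by (subst gp_arc_eq_iff[OF params]) auto
    finally show ?thesis by simp
  qed
  have "c \<in> parcs (generalized_petersen n s) \<and> fst c = snd (gp_arc n s b d x) \<longleftrightarrow>
      c \<in> ?arc ` {-1, 0, 1}" for c
  proof
    assume c: "c \<in> parcs (generalized_petersen n s) \<and> fst c = snd (gp_arc n s b d x)"
    then obtain b' e y where e: "e \<in> {-1, 0, 1}" and ce: "c = gp_arc n s b' e y"
      using n by (auto simp: parcs_generalized_petersen)
    then have "b' = (b \<noteq> (d = 0))" "int n dvd y - (x + step s b d)"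
      using c n by (auto simp: gp_arc_def point_eq_iff)
    then have "c = ?arc e" using ce gp_arc_periodic[OF n] by simp
    then show "c \<in> ?arc ` {-1, 0, 1}" using e by blast
  next
    assume "c \<in> ?arc ` {-1, 0, 1}"
    then obtain e where "e \<in> {-1, 0, 1}" "c = ?arc e" by blast
    then show "c \<in> parcs (generalized_petersen n s) \<and> fst c = snd (gp_arc n s b d x)"
      using gp_arc_in_parcs[OF n, of e s "b \<noteq> (d = 0)" "x + step s b d"] by (simp add: gp_arc_def)
  qed
  then have "?L = {c \<in> ?arc ` {-1, 0, 1}. snd c \<noteq> fst (gp_arc n s b d x)}" by blast
  also have "\<dots> = ?arc ` {e \<in> {-1, 0, 1}. e \<noteq> - d}" using backtrack by blast
  finally show ?thesis .
qed

section \<open>Enumeration of walks with indeterminate parameters\<close>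

text \<open>A code \<open>(b, d, i, j)\<close> stands for the arc of direction \<open>d\<close> at position \<open>i + j s\<close>
  on the rim \<open>b\<close>, with \<open>n\<close> and \<open>s\<close> left indeterminate.\<close>

type_synonym arc_code = "bool \<times> int \<times> int \<times> int"

definition decode_arc :: "nat \<Rightarrow> nat \<Rightarrow> arc_code \<Rightarrow> gp_vertex \<times> gp_vertex" where
  "decode_arc n s = (\<lambda>(b, d, i, j). gp_arc n s b d (i + j * int s))"

definition next_codes :: "arc_code \<Rightarrow> arc_code list" where
  "next_codes = (\<lambda>(b, d, i, j).
     map (\<lambda>e. (b \<noteq> (d = 0), e, if b then i + d else i, if b then j else j + d))
       (filter (\<lambda>e. e \<noteq> - d) [-1, 0, 1]))"

primrec walk_ends :: "nat \<Rightarrow> arc_code \<Rightarrow> arc_code list" where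
  "walk_ends 0 c = [c]"
| "walk_ends (Suc k) c = concat (map (walk_ends k) (next_codes c))"

text \<open>The displacements of the walks that come back to the initial rim and direction. The list
  does not involve \<open>n\<close> and \<open>s\<close>; a walk with displacement
  \<open>(i, j)\<close> closes up exactly when \<open>n\<close> divides \<open>i + j * s\<close>,
  which \<open>closed_count\<close> tests.\<close>

definition loops :: "nat \<Rightarrow> bool \<Rightarrow> int \<Rightarrow> (int \<times> int) list" where
  "loops k b d =
     map (snd \<circ> snd) (filter (\<lambda>(b', d', _). b' = b \<and> d' = d) (walk_ends k (b, d, 0, 0)))"

definition closed_count :: "nat \<Rightarrow> nat \<Rightarrow> (int \<times> int) list \<Rightarrow> nat" where
  "closed_count n s ps = length (filter (\<lambda>(i, j). int n dvd i + j * int s) ps)"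

lemma arc_walks_eq_sum_list:
  assumes params: "0 < s" "s < n" "2 * s \<noteq> n" and "fst (snd c) \<in> {-1, 0, 1}"
  shows "arc_walks (generalized_petersen n s) k (decode_arc n s c) a =
    sum_list (map (\<lambda>c'. of_bool (decode_arc n s c' = a)) (walk_ends k c))"
  using assms(4)
proof (induction k arbitrary: c)
  case 0
  show ?case by simp
next
  case (Suc k)
  obtain b d i j where c: "c = (b, d, i, j)" by (cases c)
  then have d: "d \<in> {-1, 0, 1}" using Suc.prems by simp
  define x where "x = i + j * int s"
  define nxt where "nxt e = (b \<noteq> (d = 0), e, if b then i + d else i, if b then j else j + d)"
    for e :: int
  define es where "es = filter (\<lambda>e. e \<noteq> - d) [-1, 0, 1]"
  have es: "set es = {e \<in> {-1, 0, 1}. e \<noteq> - d}" "distinct es" by (auto simp: es_def)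
  have dec: "gp_arc n s (b \<noteq> (d = 0)) e (x + step s b d) = decode_arc n s (nxt e)" for e
    by (auto simp: decode_arc_def nxt_def x_def step_def algebra_simps)
  \<comment> \<open>Different directions give different arcs, so the sum over the set of
    continuations turns into a sum over codes with the same multiplicities.\<close>
  have inj: "inj_on (\<lambda>e. decode_arc n s (nxt e)) (set es)"
    unfolding dec[symmetric] using d by (auto simp: inj_on_def es gp_arc_eq_iff[OF params])
  have "arc_walks (generalized_petersen n s) (Suc k) (decode_arc n s c) a =
      (\<Sum>a'\<in>(\<lambda>e. decode_arc n s (nxt e)) ` set es. arc_walks (generalized_petersen n s) k a' a)"
    using gp_arc_continuations[OF params d, of b x]
    by (simp only: arc_walks.simps c decode_arc_def prod.case x_def[symmetric])
      (simp only: dec[unfolded decode_arc_def] es)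
  also have "\<dots> = (\<Sum>e\<in>set es. arc_walks (generalized_petersen n s) k (decode_arc n s (nxt e)) a)"
    by (simp add: sum.reindex[OF inj])
  also have "\<dots> = (\<Sum>e\<in>set es.
      sum_list (map (\<lambda>c'. of_bool (decode_arc n s c' = a)) (walk_ends k (nxt e))))"
    by (intro sum.cong refl Suc.IH) (auto simp: es nxt_def)
  also have "\<dots> = (\<Sum>e\<leftarrow>es.
      sum_list (map (\<lambda>c'. of_bool (decode_arc n s c' = a)) (walk_ends k (nxt e))))"
    by (simp add: sum_list_distinct_conv_sum_set es)
  also have "\<dots> = sum_list (map (\<lambda>c'. of_bool (decode_arc n s c' = a)) (walk_ends (Suc k) c))"
  proof -
    have "walk_ends (Suc k) c = concat (map (\<lambda>e. walk_ends k (nxt e)) es)"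
      by (simp add: c next_codes_def nxt_def es_def)
    moreover have "sum_list (map f (concat xss)) = (\<Sum>xs\<leftarrow>xss. sum_list (map f xs))"
      for f :: "arc_code \<Rightarrow> nat" and xss
      by (induction xss) auto
    ultimately show ?thesis by (simp add: comp_def)
  qed
  finally show ?case .
qed

lemma walk_ends_direction:
  "c' \<in> set (walk_ends k c) \<Longrightarrow> fst (snd c) \<in> {-1, 0, 1} \<Longrightarrow> fst (snd c') \<in> {-1, 0, 1}"
proof (induction k arbitrary: c)
  case (Suc k)
  then obtain e where "e \<in> set (next_codes c)" "c' \<in> set (walk_ends k e)" by auto
  moreover from this have "fst (snd e) \<in> set [-1, 0, 1]"
    by (auto simp: next_codes_def simp del: filter.simps list.set)
  ultimately show ?case using Suc.IH[of e] by simp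
qed simp

lemma arc_walks_eq_closed_count:
  assumes params: "0 < s" "s < n" "2 * s \<noteq> n" and d: "d \<in> {-1, 0, 1}"
  shows "arc_walks (generalized_petersen n s) k (gp_arc n s b d 0) (gp_arc n s b d 0) =
    closed_count n s (loops k b d)"
proof -
  let ?c = "(b, d, 0, 0)"
  have "arc_walks (generalized_petersen n s) k (decode_arc n s ?c) (gp_arc n s b d 0) =
     (\<Sum>c\<leftarrow>walk_ends k ?c. of_bool (decode_arc n s c = gp_arc n s b d 0))"
    by (rule arc_walks_eq_sum_list[OF params]) (use d in simp)
  also have "\<dots> = (\<Sum>c\<leftarrow>walk_ends k ?c.
      of_bool ((\<lambda>(b', d', i, j). b' = b \<and> d' = d \<and> int n dvd i + j * int s) c))"
  proof (intro arg_cong[where f = sum_list] map_cong refl arg_cong[where f = of_bool])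
    fix c assume "c \<in> set (walk_ends k ?c)"
    then have "fst (snd c) \<in> {-1, 0, 1}" using walk_ends_direction d by fastforce
    then show "(decode_arc n s c = gp_arc n s b d 0) =
        (\<lambda>(b', d', i, j). b' = b \<and> d' = d \<and> int n dvd i + j * int s) c"
      using d by (cases c) (simp only: decode_arc_def prod.case fst_conv snd_conv gp_arc_eq_iff[OF params], simp)
  qed
  also have "\<dots> = closed_count n s (loops k b d)"
  proof -
    have "(\<Sum>c\<leftarrow>cs. of_bool ((\<lambda>(b', d', i, j). b' = b \<and> d' = d \<and> int n dvd i + j * int s) c)) =
      length (filter (\<lambda>(i, j). int n dvd i + j * int s)
        (map (snd \<circ> snd) (filter (\<lambda>(b', d', _). b' = b \<and> d' = d) cs)))" for cs
      by (induction cs) auto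
    then show ?thesis by (simp add: closed_count_def loops_def)
  qed
  finally show ?thesis by (simp add: decode_arc_def)
qed

section \<open>Octagons\<close>

text \<open>The entries \<open>(0, 0)\<close> are the octagons that exist for all \<open>n\<close>
  and \<open>s\<close>. They have four spokes and two edges on each rim, hence two such entries for
  the outer and for the inner arc, but four for the spoke.\<close>

lemma loops_8_outer: "loops 8 True 1 =
   [(1, -5), (2, -4), (3, -3), (4, -2), (0, -2), (0, 0), (2, -2), (2, 0), (5, -1),
    (0, 0), (0, 2), (2, 0), (2, 2), (5, 1), (4, 2), (3, 3), (2, 4), (1, 5), (2, -4),
    (3, -3), (4, -2), (5, -1), (5, 1), (4, 2), (3, 3), (2, 4), (3, -3), (4, -2),
    (5, -1), (5, 1), (4, 2), (3, 3), (4, -2), (5, -1), (5, 1), (4, 2), (5, -1),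
    (5, 1), (8, 0)]"
  by code_simp

lemma loops_8_spoke: "loops 8 True 0 =
   [(-1, -5), (1, -5), (-2, -4), (2, -4), (-3, -3), (3, -3), (-4, -2), (4, -2),
    (-5, -1), (-2, -2), (0, -2), (-2, 0), (0, 0), (0, -2), (2, -2), (0, 0), (2, 0),
    (5, -1), (-5, 1), (-2, 0), (0, 0), (-2, 2), (0, 2), (0, 0), (2, 0), (0, 2),
    (2, 2), (5, 1), (-4, 2), (4, 2), (-3, 3), (3, 3), (-2, 4), (2, 4), (-1, 5),
    (1, 5)]"
  by code_simp

lemma loops_8_inner: "loops 8 False 1 =
   [(-5, 1), (-4, 2), (-3, 3), (-2, 4), (-2, 0), (0, 0), (-2, 2), (0, 2), (-1, 5),
    (0, 0), (2, 0), (0, 2), (2, 2), (1, 5), (2, 4), (3, 3), (4, 2), (5, 1), (-4, 2),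
    (-3, 3), (-2, 4), (-1, 5), (1, 5), (2, 4), (3, 3), (4, 2), (-3, 3), (-2, 4),
    (-1, 5), (1, 5), (2, 4), (3, 3), (-2, 4), (-1, 5), (1, 5), (2, 4), (-1, 5),
    (1, 5), (0, 8)]"
  by code_simp

lemma closed_count_simps:
  "closed_count n s [] = 0"
  "closed_count n s ((i, j) # ps) = of_bool (int n dvd i + j * int s) + closed_count n s ps"
  by (simp_all add: closed_count_def)

section \<open>Comparison of the three kinds of arcs\<close>

lemma arc_transitive_closed_count:
  assumes "0 < s" "s < n" "2 * s \<noteq> n" "arc_transitive (generalized_petersen n s)"
    "d \<in> {-1, 0, 1}" "d' \<in> {-1, 0, 1}"
  shows "closed_count n s (loops k b d) = closed_count n s (loops k b' d')"
proof -
  have n: "0 < n" using assms by simp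
  have "arc_walks (generalized_petersen n s) k (gp_arc n s b d 0) (gp_arc n s b d 0) =
      arc_walks (generalized_petersen n s) k (gp_arc n s b' d' 0) (gp_arc n s b' d' 0)"
    by (intro arc_transitive_arc_walks assms parcs_subset_generalized_petersen gp_arc_in_parcs n)
  then show ?thesis using arc_walks_eq_closed_count[OF assms(1-3)] assms(5,6) by metis
qed

text \<open>Opposite vectors give the same congruence, so of each such pair only the one with
  positive first entry is kept.\<close>

definition octagon_coeffs :: "(int \<times> int) set" where
  "octagon_coeffs = {(1, 5), (2, 4), (3, 3), (4, 2), (5, 1),
     (1, -5), (2, -4), (3, -3), (4, -2), (5, -1)}"

text \<open>The first entries are positive and \<open>i + \<bar>j\<bar>\<close> is always
  \<open>6\<close>, so distinct vectors are not proportional. The bound is attained by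
  \<open>(1, 5)\<close> and \<open>(5, -1)\<close>.\<close>

lemma octagon_coeffs_det:
  assumes "(i, j) \<in> octagon_coeffs" "(i', j') \<in> octagon_coeffs" "(i, j) \<noteq> (i', j')"
  shows "i * j' - i' * j \<noteq> 0" "\<bar>i * j' - i' * j\<bar> \<le> 26"
  using assms by (auto simp: octagon_coeffs_def)

text \<open>The outer count plus the inner count minus twice the spoke count is zero. A closed walk
  with \<open>i + \<bar>j\<bar> = 6\<close> has six rim arcs and two spokes, which gives its
  congruence the weight \<open>6 - 2 * 2 = 2\<close>; the entries \<open>(0, 0)\<close> contribute
  \<open>2 + 2 - 2 * 4 = -4\<close>.\<close>

lemma octagon_equation:
  assumes params: "0 < s" "s < n" "2 * s \<noteq> n" and arc: "arc_transitive (generalized_petersen n s)"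
  defines "c \<equiv> \<lambda>i j. of_bool (int n dvd i + j * int s) :: nat"
  shows "4 + 2 * c 2 2 + 2 * c 2 (-2) = c 8 0 + c 0 8 + 2 * (\<Sum>(i, j)\<in>octagon_coeffs. c i j)"
proof -
  let ?H = "\<lambda>b d. closed_count n s (loops 8 b d)"
  have minus: "c (- i) j = c i (- j)" for i j
    using dvd_minus_iff[of "int n" "i - j * int s"] by (simp add: c_def algebra_simps)
  have minus_0: "c 0 (- j) = c 0 j" for j
    by (simp add: c_def)
  have trivial: "c 0 0 = 1" "c 2 0 = 0" "c 0 2 = 0"
    using not_dvd_double[OF params] by (simp_all add: c_def)
  have "?H True 1 + ?H False 1 = 2 * ?H True 0"
    using arc_transitive_closed_count[OF params arc, of 1 0 8 True True]
      arc_transitive_closed_count[OF params arc, of 1 0 8 False True] by simp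
  moreover have count: "closed_count n s ((i, j) # ps) = c i j + closed_count n s ps" for i j ps
    by (simp add: closed_count_simps c_def)
  ultimately show ?thesis
    unfolding loops_8_outer loops_8_spoke loops_8_inner count closed_count_simps(1) octagon_coeffs_def
    using minus[of 1] minus[of 2] minus[of 3] minus[of 4] minus[of 5] minus[of 8]
    by (simp add: minus minus_0 trivial)
qed

lemma arc_transitive_bound:
  assumes params: "0 < s" "s < n" "2 * s \<noteq> n" and arc: "arc_transitive (generalized_petersen n s)"
  shows "n \<le> 26"
proof (rule ccontr)
  assume "\<not> n \<le> 26"
  then have n: "n > 26" by simp
  define P where "P = {p \<in> octagon_coeffs. int n dvd fst p + snd p * int s}"
  have fin: "finite octagon_coeffs" by (simp add: octagon_coeffs_def)
  have "\<not> int n dvd 8" using zdvd_imp_le[of "int n" 8] n by auto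
  then have "2 \<le> (\<Sum>(i, j)\<in>octagon_coeffs. of_bool (int n dvd i + j * int s) :: nat)"
  proof -
    \<comment> \<open>The term of the outer 8-cycle vanishes and that of the inner one is at most
      \<open>1\<close>, so twice the sum is at least \<open>3\<close>.\<close>
    have "of_bool (int n dvd 8 * int s) \<le> (1 :: nat)" by simp
    then show ?thesis
      using octagon_equation[OF params arc] \<open>\<not> int n dvd 8\<close> by simp
  qed
  also have "\<dots> = card P"
    using sum.inter_filter[OF fin, of "\<lambda>_. 1 :: nat" "\<lambda>p. int n dvd fst p + snd p * int s"]
    by (simp add: P_def split_beta of_bool_def)
  finally have "\<not> card P \<le> Suc 0" by simp
  moreover have "finite P" using fin by (simp add: P_def)
  ultimately obtain p q where pq: "p \<in> P" "q \<in> P" "p \<noteq> q"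
    using card_le_Suc0_iff_eq by blast
  obtain i j i' j' where ij: "p = (i, j)" "q = (i', j')" by (cases p, cases q)
  have dvd: "int n dvd i + j * int s" "int n dvd i' + j' * int s"
    and mem: "(i, j) \<in> octagon_coeffs" "(i', j') \<in> octagon_coeffs" "(i, j) \<noteq> (i', j')"
    using pq ij by (auto simp: P_def)
  \<comment> \<open>Eliminating \<open>s\<close> from the two congruences leaves the
    determinant.\<close>
  have "i * j' - i' * j = j' * (i + j * int s) - j * (i' + j' * int s)"
    by (simp add: algebra_simps)
  then have "int n dvd i * j' - i' * j" using dvd by simp
  then have "\<bar>int n\<bar> \<le> \<bar>i * j' - i' * j\<bar>"
    by (rule dvd_imp_le_int[OF octagon_coeffs_det(1)[OF mem]])
  then show False
    using octagon_coeffs_det(2)[OF mem] n by linarith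
qed

lemma small_parameters:
  "list_all (\<lambda>n. list_all (\<lambda>s. 2 * s \<noteq> n \<longrightarrow>
      closed_count n s (loops 8 True 1) = closed_count n s (loops 8 True 0) \<longrightarrow>
      closed_count n s (loops 8 False 1) = closed_count n s (loops 8 True 0) \<longrightarrow>
      (n, s) \<in> {(4, 1), (5, 2), (8, 3), (10, 2), (10, 3), (12, 5), (24, 5)} \<or>
      (n, n - s) \<in> {(4, 1), (5, 2), (8, 3), (10, 2), (10, 3), (12, 5), (24, 5)} \<or>
      (n, s) \<in> {(13, 5), (13, 8), (26, 5), (26, 21)}) [1..<n]) [3..<27]"
  \<comment> \<open>Inserting the precomputed lists avoids enumerating the walks again for every
    pair.\<close>
  unfolding loops_8_outer loops_8_spoke loops_8_inner
  by code_simp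

text \<open>As \<open>5 * 5\<close> is \<open>-1\<close> modulo \<open>26\<close>, hence also modulo
  \<open>13\<close>, multiplication by \<open>5\<close> with an exchange of the rims is an
  automorphism for both moduli. Outer and inner arcs therefore always have equal counts, and only a
  comparison with the spokes can separate the arcs.\<close>

lemma not_arc_transitive_13_5: "\<not> arc_transitive (generalized_petersen 13 5)"
proof
  assume "arc_transitive (generalized_petersen 13 5)"
  then have "closed_count 13 5 (loops 7 True 1) = closed_count 13 5 (loops 7 True 0)"
    by (intro arc_transitive_closed_count) simp_all
  moreover have "closed_count 13 5 (loops 7 True 1) \<noteq> closed_count 13 5 (loops 7 True 0)"
    by code_simp
  ultimately show False by contradiction
qed

lemma not_arc_transitive_26_5: "\<not> arc_transitive (generalized_petersen 26 5)"
proof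
  assume "arc_transitive (generalized_petersen 26 5)"
  then have "closed_count 26 5 (loops 10 True 1) = closed_count 26 5 (loops 10 True 0)"
    by (intro arc_transitive_closed_count) simp_all
  moreover have "closed_count 26 5 (loops 10 True 1) \<noteq> closed_count 26 5 (loops 10 True 0)"
    by code_simp
  ultimately show False by contradiction
qed

section \<open>Automorphisms\<close>

text \<open>Rotations for \<open>e = 1\<close> and reflections for \<open>e = -1\<close>, extended
  by the identity outside the graph as \<open>permutes\<close> demands.\<close>

definition affine :: "nat \<Rightarrow> int \<Rightarrow> int \<Rightarrow> gp_vertex \<Rightarrow> gp_vertex" where
  "affine n e k v = (case v of
     U i \<Rightarrow> if i < n then point n True (e * int i + k) else v
   | V i \<Rightarrow> if i < n then point n False (e * int i + k) else v)"

lemma affine_point: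
  assumes "0 < n"
  shows "affine n e k (point n b x) = point n b (e * x + k)"
proof -
  have "int n dvd (e * (x mod int n) + k) - (e * x + k)"
    by (simp add: mod_eq_dvd_iff[symmetric] mod_simps)
  then have "point n b (e * (x mod int n) + k) = point n b (e * x + k)"
    using assms by (simp add: point_eq_iff)
  moreover have "nat (x mod int n) < n" using assms by (simp add: nat_less_iff)
  ultimately show ?thesis by (cases b) (simp_all add: affine_def point_def[of n _ x])
qed

lemma affine_gp_arc:
  assumes "0 < n" "e \<in> {1, -1}"
  shows "map_prod (affine n e k) (affine n e k) (gp_arc n s b d x) = gp_arc n s b (e * d) (e * x + k)"
  using assms by (auto simp: gp_arc_def affine_point step_def algebra_simps)

lemma point_in_pverts:
  assumes "0 < n"
  shows "point n b x \<in> pverts (generalized_petersen n s)"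
  unfolding pverts_generalized_petersen[OF assms] by blast

lemma affine_automorphism:
  assumes n: "0 < n" and e: "e \<in> {1, -1}"
  shows "affine n e k \<in> automorphisms (generalized_petersen n s)"
proof (rule automorphismI)
  let ?G = "generalized_petersen n s"
  \<comment> \<open>Since \<open>e * e = 1\<close>, the map sending \<open>x\<close> to
    \<open>e * x - e * k\<close> inverts the one sending \<open>x\<close> to
    \<open>e * x + k\<close>.\<close>
  have inv: "affine n e (- (e * k)) (affine n e k v) = v" "affine n e k (affine n e (- (e * k)) v) = v"
    "affine n e k v \<in> pverts ?G" "affine n e (- (e * k)) v \<in> pverts ?G"
    if v: "v \<in> pverts ?G" for v
  proof -
    obtain b x where "v = point n b x" using v n by (auto simp: pverts_generalized_petersen)
    then show "affine n e (- (e * k)) (affine n e k v) = v"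
      "affine n e k (affine n e (- (e * k)) v) = v"
      "affine n e k v \<in> pverts ?G" "affine n e (- (e * k)) v \<in> pverts ?G"
      using n e point_in_pverts by (auto simp: affine_point algebra_simps)
  qed
  have "bij_betw (affine n e k) (pverts ?G) (pverts ?G)"
    by (rule bij_betw_byWitness[where f' = "affine n e (- (e * k))"]) (use inv in auto)
  moreover have "affine n e k v = v" if "v \<notin> pverts ?G" for v
    using that by (auto simp: affine_def generalized_petersen_def split: gp_vertex.split)
  ultimately show "affine n e k permutes pverts ?G" by (rule bij_imp_permutes)
  show "finite (parcs ?G)" by (auto simp: generalized_petersen_def symcl_def)
  fix u v assume "(u, v) \<in> parcs ?G"
  then obtain b d x where d: "d \<in> {-1, 0, 1}" and uv: "(u, v) = gp_arc n s b d x"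
    using n by (auto simp: parcs_generalized_petersen)
  have "map_prod (affine n e k) (affine n e k) (u, v) \<in> parcs ?G"
    unfolding uv affine_gp_arc[OF n e] using gp_arc_in_parcs[OF n] d e by auto
  then show "(affine n e k u, affine n e k v) \<in> parcs ?G" by simp
qed

lemma edge_transitive_imp_arc_transitive_gp:
  assumes "0 < n" "edge_transitive (generalized_petersen n s)"
  shows "arc_transitive (generalized_petersen n s)"
proof (rule edge_transitive_imp_arc_transitive[OF assms(2)])
  show "(point n True 0, point n True 1) \<in> parcs (generalized_petersen n s)"
    using gp_arc_in_parcs[OF assms(1), of 1 s True 0] by (simp add: gp_arc_def step_def)
  \<comment> \<open>The reflection sending \<open>x\<close> to \<open>1 - x\<close> exchanges the
    two ends of the chosen outer edge.\<close>
  show "affine n (-1) 1 \<in> automorphisms (generalized_petersen n s)"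
    using assms(1) by (rule affine_automorphism) simp
qed (simp_all add: affine_point assms(1))

text \<open>Rotations and reflections have four orbits on arcs: outer arcs, inner arcs, and spokes
  in either direction. The map \<open>f\<close> joins the outer orbit to the inner one and to one
  orbit of spokes; reversing arcs brings in the other.\<close>

lemma arc_transitive_gpI:
  assumes n: "0 < n" and f: "f \<in> automorphisms (generalized_petersen n s)"
    and spoke: "map_prod f f (gp_arc n s True 1 x) = gp_arc n s True 0 x'"
    and inner: "map_prod f f (gp_arc n s True 1 y) = gp_arc n s False d y'" and d: "d \<in> {1, -1}"
  shows "arc_transitive (generalized_petersen n s)"
proof (rule arc_transitiveI)
  let ?G = "generalized_petersen n s"
  define R where "R a \<longleftrightarrow> (\<exists>g\<in>automorphisms ?G. map_prod g g (gp_arc n s True 1 0) = a)" for a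
  have R_map: "R (map_prod g g a)" if a: "R a" and g: "g \<in> automorphisms ?G" for g a
  proof -
    obtain h where "h \<in> automorphisms ?G" "map_prod h h (gp_arc n s True 1 0) = a"
      using a unfolding R_def by blast
    then show ?thesis
      unfolding R_def using automorphisms_comp[OF _ g]
      by (intro bexI[of _ "g \<circ> h"]) (auto simp: prod.map_comp)
  qed
  have R_affine: "R (gp_arc n s b (e * d) z)" if "R (gp_arc n s b d x)" "e \<in> {1, -1}" for b e d x z
    using R_map[OF that(1) affine_automorphism[OF n that(2)], of "z - e * x"]
    by (simp add: affine_gp_arc[OF n that(2)])
  have "R (gp_arc n s True 1 0)"
    unfolding R_def by (rule bexI[OF _ automorphisms_id]) (simp add: prod.map_id)
  then have outer: "R (gp_arc n s True e z)" if "e \<in> {1, -1}" for e z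
    using R_affine[of True 1 0 e z] that by simp
  have "R (gp_arc n s True 0 x')"
    using R_map[OF outer f, of 1 x] spoke by simp
  then have spokes: "R (gp_arc n s True 0 z)" for z
    using R_affine[of True 0 x' 1 z] by simp
  have "R (gp_arc n s False d y')"
    using R_map[OF outer f, of 1 y] inner by simp
  then have inners: "R (gp_arc n s False e z)" if "e \<in> {1, -1}" for e z
    using R_affine[of False d y' "e * d" z] d that by auto
  have swap: "map_prod f f (prod.swap a) = prod.swap (map_prod f f a)" for a
    by (cases a) simp
  \<comment> \<open>The reverse of an outer arc is again outer, and \<open>f\<close> takes it to a
    spoke that starts on the inner rim.\<close>
  have "R (map_prod f f (prod.swap (gp_arc n s True 1 x)))"
    by (rule R_map[OF _ f]) (use outer in \<open>simp add: swap_gp_arc\<close>)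
  then have "R (gp_arc n s False 0 x')"
    unfolding swap spoke by (simp add: swap_gp_arc step_def)
  then have spokes': "R (gp_arc n s False 0 z)" for z
    using R_affine[of False 0 x' 1 z] by simp
  fix a assume "a \<in> parcs ?G"
  then obtain b e z where "e \<in> {-1, 0, 1}" "a = gp_arc n s b e z"
    using n by (auto simp: parcs_generalized_petersen)
  then have "R a" using outer spokes inners spokes' by (cases b) auto
  then show "\<exists>g\<in>automorphisms ?G. map_prod g g (gp_arc n s True 1 0) = a" by (simp add: R_def)
qed

section \<open>Automorphisms given by explicit tables\<close>

fun gp_adjacent :: "nat \<Rightarrow> nat \<Rightarrow> gp_vertex \<Rightarrow> gp_vertex \<Rightarrow> bool" where
  "gp_adjacent n s (U i) (U j) \<longleftrightarrow> j = (i + 1) mod n \<or> i = (j + 1) mod n"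
| "gp_adjacent n s (V i) (V j) \<longleftrightarrow> j = (i + s) mod n \<or> i = (j + s) mod n"
| "gp_adjacent n s (U i) (V j) \<longleftrightarrow> i = j"
| "gp_adjacent n s (V i) (U j) \<longleftrightarrow> i = j"

lemma in_symcl_iff: "(u, v) \<in> symcl A \<longleftrightarrow> (u, v) \<in> A \<or> (v, u) \<in> A"
  by (auto simp: symcl_def)

text \<open>A table has to send arcs to arcs; this implication transfers the adjacencies found by
  evaluation to the graph.\<close>

lemma gp_adjacent_imp_arc:
  assumes "gp_adjacent n s u v" "u \<in> pverts (generalized_petersen n s)" "v \<in> pverts (generalized_petersen n s)"
  shows "(u, v) \<in> parcs (generalized_petersen n s)"
  using assms
  by (cases "(n, s, u, v)" rule: gp_adjacent.cases)
     (auto simp: generalized_petersen_def in_symcl_iff)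

text \<open>Numbers below \<open>n\<close> denote outer vertices, the next \<open>n\<close> inner
  ones. Positions in a list follow the same numbering, so a table gives the images of the outer
  vertices and then those of the inner ones.\<close>

definition vertex_table :: "nat \<Rightarrow> nat list \<Rightarrow> gp_vertex list" where
  "vertex_table n ks = map (\<lambda>k. if k < n then U k else V (k - n)) ks"

text \<open>The conditions on the first three entries say that the automorphism maps
  one outer edge to a spoke and the next one to an inner edge.\<close>

definition mixing_table :: "nat \<Rightarrow> nat \<Rightarrow> gp_vertex list \<Rightarrow> bool" where
  "mixing_table n s vs \<longleftrightarrow>
     length vs = 2 * n \<and> distinct vs \<and>
     list_all (\<lambda>v. case v of U i \<Rightarrow> i < n | V i \<Rightarrow> i < n) vs \<and>
     list_all (\<lambda>i. gp_adjacent n s (vs ! i) (vs ! ((i + 1) mod n)) \<and>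
                   gp_adjacent n s (vs ! i) (vs ! (n + i)) \<and>
                   gp_adjacent n s (vs ! (n + i)) (vs ! (n + (i + s) mod n))) [0..<n] \<and>
     vs ! 0 = U 0 \<and> vs ! 1 = V 0 \<and> (vs ! 2 = V s \<or> vs ! 2 = V (n - s))"

text \<open>A list of \<open>2 * n\<close> distinct vertices is a permutation of the vertex set. The
  outer arcs leaving \<open>U 0\<close> and \<open>U 1\<close> in direction \<open>1\<close> then
  serve as the two arcs in \<open>arc_transitive_gpI\<close>.\<close>

lemma mixing_table_arc_transitive:
  assumes table: "mixing_table n s vs" and s0: "0 < s" and s: "s < n" and n: "2 < n"
  shows "arc_transitive (generalized_petersen n s)"
proof -
  let ?G = "generalized_petersen n s"
  have len: "length vs = 2 * n" and dist: "distinct vs" using table by (auto simp: mixing_table_def)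
  define f where "f v = (case v of
      U i \<Rightarrow> if i < n then vs ! i else v
    | V i \<Rightarrow> if i < n then vs ! (n + i) else v)" for v
  have "set vs \<subseteq> pverts ?G"
  proof
    fix v assume "v \<in> set vs"
    then have "case v of U i \<Rightarrow> i < n | V i \<Rightarrow> i < n"
      using table by (simp add: mixing_table_def list_all_iff)
    then show "v \<in> pverts ?G" by (cases v) (simp_all add: generalized_petersen_def)
  qed
  then have nth: "vs ! i \<in> pverts ?G" if "i < 2 * n" for i
    using that len nth_mem[of i vs] by auto
  have "inj_on f (pverts ?G)"
    using dist len by (auto simp: inj_on_def f_def generalized_petersen_def nth_eq_iff_index_eq)
  moreover have sub: "f ` pverts ?G \<subseteq> pverts ?G"
  proof -
    have "f v \<in> pverts ?G" if v: "v \<in> pverts ?G" for v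
    proof -
      obtain i where "v = U i \<or> v = V i" "i < n" using v by (auto simp: generalized_petersen_def)
      then show ?thesis using nth by (auto simp: f_def)
    qed
    then show ?thesis by blast
  qed
  moreover have "finite (pverts ?G)" by (simp add: generalized_petersen_def)
  ultimately have "bij_betw f (pverts ?G) (pverts ?G)"
    by (simp add: bij_betw_def endo_inj_surj)
  then have perm: "f permutes pverts ?G"
    by (rule bij_imp_permutes) (auto simp: f_def generalized_petersen_def split: gp_vertex.split)
  have adj: "gp_adjacent n s (vs ! i) (vs ! ((i + 1) mod n))" "gp_adjacent n s (vs ! i) (vs ! (n + i))"
    "gp_adjacent n s (vs ! (n + i)) (vs ! (n + (i + s) mod n))" if "i < n" for i
    using table that by (auto simp: mixing_table_def list_all_iff)
  have sym: "(u, v) \<in> parcs ?G \<longleftrightarrow> (v, u) \<in> parcs ?G" for u v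
    by (auto simp: generalized_petersen_def in_symcl_iff)
  \<comment> \<open>The table is checked on one orientation of each edge; symmetry of the arc
    relation gives the other.\<close>
  define A where "A = (\<lambda>i. (U i, U ((i + 1) mod n))) ` {0..<n} \<union> (\<lambda>i. (U i, V i)) ` {0..<n} \<union>
     (\<lambda>i. (V i, V ((i + s) mod n))) ` {0..<n}"
  have A: "parcs ?G = symcl A" by (simp add: generalized_petersen_def A_def)
  have fA: "(f u, f v) \<in> parcs ?G" if "(u, v) \<in> A" for u v
  proof -
    have "gp_adjacent n s (f u) (f v)" using that adj n by (auto simp: A_def f_def)
    moreover have "u \<in> pverts ?G" "v \<in> pverts ?G" using that by (auto simp: A_def generalized_petersen_def)
    ultimately show ?thesis using sub by (intro gp_adjacent_imp_arc) auto
  qed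
  have aut: "f \<in> automorphisms ?G"
  proof (rule automorphismI[OF perm])
    show "finite (parcs ?G)" unfolding A by (simp add: A_def symcl_def)
    fix u v assume "(u, v) \<in> parcs ?G"
    then have "(u, v) \<in> A \<or> (v, u) \<in> A" by (simp add: A in_symcl_iff)
    then show "(f u, f v) \<in> parcs ?G" using fA sym by blast
  qed
  have f: "f (U 0) = U 0" "f (U 1) = V 0" "f (U 2) = V s \<or> f (U 2) = V (n - s)"
    using table n by (auto simp: f_def mixing_table_def)
  have point: "point n True 0 = U 0" "point n True 1 = U 1" "point n True 2 = U 2"
    "point n False 0 = V 0" "point n False (int s) = V s"
    using n s by (simp_all add: point_def)
  \<comment> \<open>The alternative \<open>V (n - s)\<close> for the third entry is the inner step
    from \<open>V 0\<close> in direction \<open>-1\<close>.\<close>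
  have "point n False (- int s) = V (n - s)"
  proof -
    have "point n False (- int s) = point n False (int (n - s))"
      using n s by (simp add: point_eq_iff of_nat_diff)
    also have "\<dots> = V (n - s)" by (rule V_eq_point[symmetric]) (use s0 n in simp)
    finally show ?thesis .
  qed
  then have "\<exists>d\<in>{1, -1}. map_prod f f (gp_arc n s True 1 1) = gp_arc n s False d 0"
    using f point by (auto simp: gp_arc_def step_def)
  moreover have "map_prod f f (gp_arc n s True 1 0) = gp_arc n s True 0 0"
    using f point by (simp add: gp_arc_def step_def)
  ultimately show ?thesis
    using arc_transitive_gpI[OF _ aut] n by auto
qed

lemma mixing_tables:
  "mixing_table 4 1 (vertex_table 4
    [0, 4, 5, 1, 3, 7, 6, 2])"
  "mixing_table 5 2 (vertex_table 5
    [0, 5, 8, 6, 1, 4, 7, 3, 9, 2])"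
  "mixing_table 8 3 (vertex_table 8
    [0, 8, 13, 5, 4, 12, 9, 1, 7, 11, 10, 6, 3, 15, 14, 2])"
  "mixing_table 10 2 (vertex_table 10
    [0, 10, 18, 16, 6, 5, 15, 13, 11, 1, 9, 12, 8, 14, 7, 4, 17, 3, 19, 2])"
  "mixing_table 10 3 (vertex_table 10
    [0, 10, 17, 7, 6, 5, 15, 12, 2, 1, 9, 13, 14, 8, 16, 4, 18, 19, 3, 11])"
  "mixing_table 12 5 (vertex_table 12
    [0, 12, 17, 5, 4, 16, 21, 9, 8, 20, 13, 1, 11, 19, 22, 6, 3, 23, 14, 10, 7, 15, 18,
     2])"
  "mixing_table 24 5 (vertex_table 24
    [0, 24, 29, 5, 4, 28, 33, 9, 8, 32, 37, 13, 12, 36, 41, 17, 16, 40, 45, 21, 20, 44,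
     25, 1, 23, 43, 34, 6, 3, 47, 38, 10, 7, 27, 42, 14, 11, 31, 46, 18, 15, 35, 26, 22,
     19, 39, 30, 2])"
  by code_simp+

lemma arc_transitive_generalized_petersen:
  assumes "(n, s) \<in> {(4, 1), (5, 2), (8, 3), (10, 2), (10, 3), (12, 5), (24, 5)}"
  shows "arc_transitive (generalized_petersen n s)"
  using assms by (auto simp del: One_nat_def intro: mixing_tables[THEN mixing_table_arc_transitive])

lemma arc_transitive_parameters:
  assumes params: "0 < s" "s < n" "2 * s \<noteq> n" and arc: "arc_transitive (generalized_petersen n s)"
  shows "\<exists>t. (t = s \<or> t = n - s) \<and>
    (n, t) \<in> {(4, 1), (5, 2), (8, 3), (10, 2), (10, 3), (12, 5), (24, 5)}"
proof -
  have "n \<in> set [3..<27]" "s \<in> set [1..<n]"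
    unfolding set_upt atLeastLessThan_iff using arc_transitive_bound[OF params arc] params by linarith+
  moreover have "closed_count n s (loops 8 True 1) = closed_count n s (loops 8 True 0)"
    and "closed_count n s (loops 8 False 1) = closed_count n s (loops 8 True 0)"
    by (rule arc_transitive_closed_count[OF params arc]; simp)+
  ultimately have "(n, s) \<in> {(4, 1), (5, 2), (8, 3), (10, 2), (10, 3), (12, 5), (24, 5)} \<or>
      (n, n - s) \<in> {(4, 1), (5, 2), (8, 3), (10, 2), (10, 3), (12, 5), (24, 5)} \<or>
      (n, s) \<in> {(13, 5), (13, 8), (26, 5), (26, 21)}"
    by (rule small_parameters[unfolded list_all_iff, rule_format, OF _ _ params(3)])
  \<comment> \<open>As \<open>8 = 13 - 5\<close> and \<open>21 = 26 - 5\<close>, changing the sign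
    of \<open>s\<close> reduces all four pairs to \<open>s = 5\<close>.\<close>
  moreover have "(n, s) \<notin> {(13, 5), (13, 8), (26, 5), (26, 21)}"
    using arc not_arc_transitive_13_5 not_arc_transitive_26_5
      generalized_petersen_uminus[of 5 13] generalized_petersen_uminus[of 5 26] by auto
  ultimately show ?thesis by metis
qed

text \<open>The listed pairs represent \<open>s\<close> only up to sign, since \<open>s\<close> and
  \<open>n - s\<close> define the same graph; the witness \<open>t\<close> is whichever of the two
  appears in the list.\<close>

theorem theorem6p1:
  fixes n s :: nat
  assumes "0 < n" and "s \<in> {0..<n} - {0}" and "2 * s \<noteq> n"
  shows "(edge_transitive (generalized_petersen n s) \<longleftrightarrow>
            (\<exists>t. (t = s \<or> t = n - s) \<and>
                 (n, t) \<in> {(4,1), (5,2), (8,3), (10,2), (10,3), (12,5), (24,5)})) \<and>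
         (edge_transitive (generalized_petersen n s) \<longrightarrow>
            arc_transitive (generalized_petersen n s))"
proof -
  have params: "0 < s" "s < n" "2 * s \<noteq> n" using assms by auto
  show ?thesis
  proof (intro conjI iffI impI)
    assume "edge_transitive (generalized_petersen n s)"
    then show arc: "arc_transitive (generalized_petersen n s)"
      by (rule edge_transitive_imp_arc_transitive_gp[OF assms(1)])
    show "\<exists>t. (t = s \<or> t = n - s) \<and>
        (n, t) \<in> {(4,1), (5,2), (8,3), (10,2), (10,3), (12,5), (24,5)}"
      by (rule arc_transitive_parameters[OF params arc])
  next
    assume "\<exists>t. (t = s \<or> t = n - s) \<and>
        (n, t) \<in> {(4,1), (5,2), (8,3), (10,2), (10,3), (12,5), (24,5)}"
    then obtain t where t: "t = s \<or> t = n - s"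
      and "(n, t) \<in> {(4,1), (5,2), (8,3), (10,2), (10,3), (12,5), (24,5)}" by (elim exE conjE)
    then have "arc_transitive (generalized_petersen n t)"
      by (intro arc_transitive_generalized_petersen)
    moreover have "generalized_petersen n t = generalized_petersen n s"
      using t generalized_petersen_uminus[OF params(2)] by metis
    ultimately show "edge_transitive (generalized_petersen n s)"
      using arc_transitive_imp_edge_transitive by metis
  qed
qed

end
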